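(* Let $(f_0,f_1,f_2)$ be a coloring of $D_3(m)$ and let $(f'_0,f'_1,f'_2)$ be obtained from it by a Kempe swap of two colors $(r,s)$ on a set $X$ that is a union of cycles of $\tau_{r,s}=f_s^{-1}\circ f_r$. Then \[\mathrm{sgn}(f'_0)\,\mathrm{sgn}(f'_1)\,\mathrm{sgn}(f'_2)=\mathrm{sgn}(f_0)\,\mathrm{sgn}(f_1)\,\mathrm{sgn}(f_2),\] where $\mathrm{sgn}$ denotes the sign of a permutation of $V$.
   Context: Let $m\ge 3$, $V=(\mathbb Z_m)^3$, and $e_1,e_2,e_3$ the standard basis vectors; $D_3(m)$ is the digraph on $V$ with arcs $v\to v+e_1,v+e_2,v+e_3$ (mod $m$). A coloring of $D_3(m)$ is a triple $(f_0,f_1,f_2)$ of permutations of $V$ such that $\{f_0(v),f_1(v),f_2(v)\}=\{v+e_1,v+e_2,v+e_3\}$ for every $v\in V$. For colors $r\ne s$ the Kempe map is $\tau_{r,s}=f_s^{-1}\circ f_r$. For $X\subseteq V$, the Kempe swap of colors $(r,s)$ on $X$ produces $f'_r(v)=f_s(v)$, $f'_s(v)=f_r(v)$ for $v\in X$, $f'_r(v)=f_r(v)$, $f'_s(v)=f_s(v)$ for $v\notin X$, and $f'_t=f_t$ for the third color $t$. *)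

theory Defs
  imports "HOL-Combinatorics.Combinatorics"
begin

text \<open>
  Residues modulo \<open>m\<close> are represented by \<open>0, ..., m - 1\<close>, so that \<open>(\<int>/m)\<^sup>3\<close> is a finite
  carrier set and \<open>m\<close> remains a variable.
\<close>

type_synonym vertex = "nat \<times> nat \<times> nat"

definition verts3 :: "nat \<Rightarrow> vertex set" where
  "verts3 m = {..<m} \<times> {..<m} \<times> {..<m}"

fun add_mod :: "nat \<Rightarrow> vertex \<Rightarrow> vertex \<Rightarrow> vertex" where
  "add_mod m (x, y, z) (x', y', z') = ((x + x') mod m, (y + y') mod m, (z + z') mod m)"

definition out_nbrs :: "nat \<Rightarrow> vertex \<Rightarrow> vertex set" where
  "out_nbrs m v = {add_mod m v (1, 0, 0), add_mod m v (0, 1, 0), add_mod m v (0, 0, 1)}"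

text \<open>
  Colors are the indices \<open>0, 1, 2\<close>; the values of \<open>f\<close> at indices \<open>\<ge> 3\<close> play no role.
  By \<^const>\<open>permutes\<close>, a permutation of the vertex set is extended by the identity to the
  whole type, which changes neither its inverse on the vertex set nor its sign.
\<close>

definition coloring :: "nat \<Rightarrow> (nat \<Rightarrow> vertex \<Rightarrow> vertex) \<Rightarrow> bool" where
  "coloring m f \<longleftrightarrow>
     (\<forall>c<3. f c permutes verts3 m) \<and>
     (\<forall>v\<in>verts3 m. {f 0 v, f 1 v, f 2 v} = out_nbrs m v)"

definition kempe_map :: "(nat \<Rightarrow> vertex \<Rightarrow> vertex) \<Rightarrow> nat \<Rightarrow> nat \<Rightarrow> vertex \<Rightarrow> vertex" where
  "kempe_map f r s = inv (f s) \<circ> f r"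

definition kempe_swap ::
  "(nat \<Rightarrow> vertex \<Rightarrow> vertex) \<Rightarrow> nat \<Rightarrow> nat \<Rightarrow> vertex set \<Rightarrow> nat \<Rightarrow> vertex \<Rightarrow> vertex" where
  "kempe_swap f r s X =
     f(r := (\<lambda>v. if v \<in> X then f s v else f r v),
       s := (\<lambda>v. if v \<in> X then f r v else f s v))"

text \<open>
  The cycles of \<open>p\<close> on \<open>V\<close> are taken as sets of points; a fixed point forms a cycle of length one.
\<close>

definition union_of_cycles :: "('a \<Rightarrow> 'a) \<Rightarrow> 'a set \<Rightarrow> 'a set \<Rightarrow> bool" where
  "union_of_cycles p V X \<longleftrightarrow> (\<exists>\<C>. (\<forall>C\<in>\<C>. C \<subseteq> V \<and> cyclic_on p C) \<and> X = \<Union>\<C>)"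

lemma swap_permutes:
  assumes g: "g permutes V" and h: "h permutes V" and V: "finite V"
    and X: "union_of_cycles (inv h \<circ> g) V X"
  shows "(\<lambda>v. if v \<in> X then h v else g v) permutes V"
proof -
  let ?p = "inv h \<circ> g"
  have p: "?p permutes V"
    using g h by (simp add: permutes_compose permutes_inv)
  from X obtain \<C> where C: "\<And>C. C \<in> \<C> \<Longrightarrow> C \<subseteq> V \<and> cyclic_on ?p C" and XC: "X = \<Union>\<C>"
    unfolding union_of_cycles_def by blast
  have XV: "X \<subseteq> V" using C XC by blast
  have "?p ` X \<subseteq> X"
    using C XC by (fastforce dest: cyclic_on_inI)
  then have "?p ` X = X"
    using endo_inj_surj[OF finite_subset[OF XV V]] inj_on_subset[OF permutes_inj[OF p]] by blast
  moreover have "h (?p x) = g x" for x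
    using permutes_inverses(1)[OF h] by simp
  ultimately have img: "h ` X = g ` X"
    using image_image[of h ?p X] by simp
  have "h ` X \<inter> g ` (V - X) = {}"
    unfolding img using inj_on_image_set_diff[OF permutes_inj[OF g], of V X] by auto
  moreover have "bij_betw h X (h ` X)" "bij_betw g (V - X) (g ` (V - X))"
    using permutes_inj[OF h] permutes_inj[OF g] by (auto intro: inj_on_imp_bij_betw inj_on_subset)
  ultimately have "bij_betw (\<lambda>v. if v \<in> X then h v else g v) (X \<union> (V - X)) (h ` X \<union> g ` (V - X))"
    by (rule bij_betw_disjoint_Un[rotated 3]) auto
  moreover have "h ` X \<union> g ` (V - X) = V"
    unfolding img image_Un[symmetric] using XV permutes_image[OF g] by (simp add: Un_absorb1)
  ultimately have "bij_betw (\<lambda>v. if v \<in> X then h v else g v) V V"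
    using XV by (simp add: Un_absorb1)
  then show ?thesis
    using XV permutes_not_in[OF g] by (intro bij_imp_permutes) auto
qed

text \<open>
  The maps obtained by a Kempe swap are again permutations of the vertex set, so their signs
  (\<^const>\<open>sign\<close> is a total function) are meaningful.
\<close>

lemma coloring_kempe_swap:
  assumes f: "coloring m f" and rs: "r < 3" "s < 3" "r \<noteq> s"
    and X: "union_of_cycles (kempe_map f r s) (verts3 m) X"
  shows "coloring m (kempe_swap f r s X)"
proof -
  let ?V = "verts3 m" and ?p = "kempe_map f r s"
  have V: "finite ?V" by (simp add: verts3_def)
  have perm: "f c permutes ?V" if "c < 3" for c
    using f that by (simp add: coloring_def)
  have p: "?p permutes ?V"
    unfolding kempe_map_def using perm rs by (simp add: permutes_compose permutes_inv)
  have "inv ?p = inv (f r) \<circ> f s"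
    unfolding kempe_map_def
    using o_inv_distrib[OF permutes_bij[OF permutes_inv[OF perm[OF rs(2)]]] permutes_bij[OF perm[OF rs(1)]]]
    by (simp add: inv_inv_eq[OF permutes_bij[OF perm[OF rs(2)]]])
  moreover have "cyclic_on (inv ?p) C" if "cyclic_on ?p C" for C
    using that orbit_inv_eq permutes_imp_permutation[OF V p] unfolding cyclic_on_def by metis
  ultimately have X': "union_of_cycles (inv (f r) \<circ> f s) ?V X"
    using X unfolding union_of_cycles_def by metis
  have "\<forall>c<3. kempe_swap f r s X c permutes ?V"
    using swap_permutes[OF perm perm V X[unfolded kempe_map_def]] swap_permutes[OF perm perm V X']
      perm rs by (simp add: kempe_swap_def)
  moreover have "{kempe_swap f r s X 0 v, kempe_swap f r s X 1 v, kempe_swap f r s X 2 v}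
      = {f 0 v, f 1 v, f 2 v}" for v
  proof -
    have "r \<in> {0, 1, 2}" "s \<in> {0, 1, 2}" using rs by auto
    with rs(3) show ?thesis by (auto simp: kempe_swap_def)
  qed
  ultimately show ?thesis using f by (simp add: coloring_def)
qed

end

theory Submission
  imports Defs
begin

text \<open>
  Let \<open>q\<close> act as the Kempe map on \<open>X\<close> and as the identity elsewhere. Since \<open>q\<close> preserves \<open>X\<close>,
  \<open>f\<^sub>r = f'\<^sub>r \<circ> q\<close> and \<open>f'\<^sub>s = f\<^sub>s \<circ> q\<close>, so the signs of \<open>f\<^sub>r\<close> and \<open>f\<^sub>s\<close> both change by the
  factor \<open>sgn q\<close>, which cancels in the product.
\<close>

lemma sign_swap_on_cycles:
  assumes g: "g permutes V" and h: "h permutes V" and V: "finite V"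
    and X: "union_of_cycles (inv h \<circ> g) V X"
  shows "sign (\<lambda>v. if v \<in> X then h v else g v) * sign (\<lambda>v. if v \<in> X then g v else h v)
    = sign g * sign h"
proof -
  define q where "q = perm_restrict (inv h \<circ> g) X"
  define g' where "g' = (\<lambda>v. if v \<in> X then h v else g v)"
  define h' where "h' = (\<lambda>v. if v \<in> X then g v else h v)"
  have g': "g' permutes V"
    unfolding g'_def using swap_permutes[OF g h V X] .
  have closed: "(inv h \<circ> g) v \<in> X" if "v \<in> X" for v
    using X that unfolding union_of_cycles_def by (metis UnionE UnionI cyclic_on_inI)
  \<comment> \<open>For \<open>v\<close> in \<open>X\<close>, \<open>closed\<close> keeps
    \<open>q v\<close> in \<open>X\<close>, so \<open>g'\<close> acts on it as \<open>h\<close> and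
    cancels \<open>inv h\<close>; off \<open>X\<close>, \<open>q\<close> fixes
    \<open>v\<close>.\<close>
  have g_eq: "g = g' \<circ> q"
    using closed permutes_inverses(1)[OF h]
    by (auto simp: fun_eq_iff g'_def q_def perm_restrict_def)
  have h'_eq: "h' = h \<circ> q"
    using permutes_inverses(1)[OF h] by (auto simp: fun_eq_iff h'_def q_def perm_restrict_def)
  \<comment> \<open>As a quotient of two permutations of \<open>V\<close>, \<open>q\<close> is
    itself one, so \<open>sign_compose\<close> applies to it.\<close>
  have "q = inv g' \<circ> g"
    using permutes_inverses(2)[OF g'] by (simp add: g_eq fun_eq_iff)
  then have q: "permutation q"
    using permutes_imp_permutation[OF V] permutes_compose[OF g permutes_inv[OF g']] by simp
  have "sign g = sign g' * sign q" "sign h' = sign h * sign q"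
    using sign_compose[OF _ q] permutes_imp_permutation[OF V] g' h
    by (simp_all add: g_eq h'_eq)
  then show ?thesis
    by (simp add: g'_def h'_def)
qed

theorem theorem2p5:
  fixes m r s :: nat
    and f f' :: "nat \<Rightarrow> vertex \<Rightarrow> vertex"
    and X :: "vertex set"
  assumes "m \<ge> 3"
    and "coloring m f"
    and "r < 3" and "s < 3" and "r \<noteq> s"
    and "union_of_cycles (kempe_map f r s) (verts3 m) X"
    and "f' = kempe_swap f r s X"
  shows "sign (f' 0) * sign (f' 1) * sign (f' 2) = sign (f 0) * sign (f 1) * sign (f 2)"
proof -
  have "finite (verts3 m)"
    by (simp add: verts3_def)
  then have eq: "sign (f' r) * sign (f' s) = sign (f r) * sign (f s)"
    using sign_swap_on_cycles[of "f r" "verts3 m" "f s" X] assms(2-6)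
    by (simp add: assms(7) kempe_swap_def coloring_def kempe_map_def)
  have "f' t = f t" if "t \<noteq> r" "t \<noteq> s" for t
    using that by (simp add: assms(7) kempe_swap_def)
  \<comment> \<open>Explicit sets allow a split over the ordered pairs of distinct colors; the third
    color keeps its sign.\<close>
  moreover have "r \<in> {0, 1, 2}" "s \<in> {0, 1, 2}"
    using assms(3,4) by auto
  ultimately show ?thesis
    using eq assms(5) by (auto simp: mult_ac)
qed

end
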